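(* Let $\mathcal{B}=(e_n)_{n=1}^{\infty}$ be a basis of a real Banach space $\mathbb{X}$. Then, for every $x\in\mathbb{X}$ with $x\neq 0$, neither of the sequences $(\mathcal{D}_m^*(x))_{m\in\mathbb{N}}$ and $(\mathcal{D}_m(x))_{m\in\mathbb{N}}$ converges to zero as $m\to+\infty$.
   Context: Let $(\mathbb{X},\|\cdot\|)$ be a real Banach space. A "basis" of $\mathbb{X}$ means a semi-normalized Schauder basis $\mathcal{B}=(e_n)_{n=1}^{\infty}$ with biorthogonal functionals $(e_n^* )_{n=1}^\infty\subset\mathbb{X}^*$, i.e.: (i) there exist $a,b>0$ with $a\le\|e_n\|,\|e_n^*\|\le b$ for all $n\in\mathbb{N}$; (ii) $e_k^*(e_n)=\delta_{kn}$ for all $k,n$; (iii) the projections $P_m(x)=\sum_{n=1}^m e_n^*(x)e_n$ satisfy $\lim_m\|P_m(x)-x\|=0$ for every $x\in\mathbb{X}$. For a finite set $A\subset\mathbb{N}$ and signs $\varepsilon=(\varepsilon_n)$ with $|\varepsilon_n|=1$ for all $n$ (written $|\varepsilon|=1$; here $\varepsilon_n\in\{\pm1\}$), put $\mathbf{1}_A=\sum_{n\in A}e_n$ and $\mathbf{1}_{\varepsilon A}=\sum_{n\in A}\varepsilon_n e_n$. Denote by $|A|$ the cardinality of $A$. For $x\in\mathbb{X}$ and $m\in\mathbb{N}$ define $$\mathcal{D}_m(x)=\inf\{\|x-\alpha\mathbf{1}_A\|:\alpha\in\mathbb{R},\ A\subset\mathbb{N},\ |A|=m\},$$ $$\mathcal{D}_m^*(x)=\inf\{\|x-\alpha\mathbf{1}_{\varepsilon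 A}\|:\alpha\in\mathbb{R},\ A\subset\mathbb{N},\ |A|=m,\ |\varepsilon|=1\}.$$ *)

theory Defs
  imports "HOL-Analysis.Analysis"
begin

(* Basis vectors and biorthogonal functionals are indexed by nat, starting at 0,
   instead of by the positive integers. The norm of e' n is the operator norm. *)

definition partial_sum_proj ::
    "(nat \<Rightarrow> 'a::banach) \<Rightarrow> (nat \<Rightarrow> 'a \<Rightarrow>\<^sub>L real) \<Rightarrow> nat \<Rightarrow> 'a \<Rightarrow> 'a" where
  "partial_sum_proj e e' m x = (\<Sum>n<m. blinfun_apply (e' n) x *\<^sub>R e n)"

definition seminormalized_schauder_basis ::
    "(nat \<Rightarrow> 'a::banach) \<Rightarrow> (nat \<Rightarrow> 'a \<Rightarrow>\<^sub>L real) \<Rightarrow> bool" where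
  "seminormalized_schauder_basis e e' \<longleftrightarrow>
     (\<exists>a>0. \<exists>b>0. \<forall>n. a \<le> norm (e n) \<and> norm (e n) \<le> b \<and> a \<le> norm (e' n) \<and> norm (e' n) \<le> b) \<and>
     (\<forall>k n. blinfun_apply (e' k) (e n) = (if k = n then 1 else 0)) \<and>
     (\<forall>x. (\<lambda>m. norm (partial_sum_proj e e' m x - x)) \<longlonglongrightarrow> 0)"

definition indicator_sum :: "(nat \<Rightarrow> 'a::real_normed_vector) \<Rightarrow> nat set \<Rightarrow> 'a" where
  "indicator_sum e A = (\<Sum>n\<in>A. e n)"

definition signed_indicator_sum ::
    "(nat \<Rightarrow> 'a::real_normed_vector) \<Rightarrow> (nat \<Rightarrow> real) \<Rightarrow> nat set \<Rightarrow> 'a" where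
  "signed_indicator_sum e \<epsilon> A = (\<Sum>n\<in>A. \<epsilon> n *\<^sub>R e n)"

definition D_err :: "(nat \<Rightarrow> 'a::real_normed_vector) \<Rightarrow> nat \<Rightarrow> 'a \<Rightarrow> real" where
  "D_err e m x =
     Inf {norm (x - \<alpha> *\<^sub>R indicator_sum e A) | \<alpha> A. finite A \<and> card A = m}"

definition D_star_err :: "(nat \<Rightarrow> 'a::real_normed_vector) \<Rightarrow> nat \<Rightarrow> 'a \<Rightarrow> real" where
  "D_star_err e m x =
     Inf {norm (x - \<alpha> *\<^sub>R signed_indicator_sum e \<epsilon> A) | \<alpha> A \<epsilon>.
            finite A \<and> card A = m \<and> (\<forall>n. \<bar>\<epsilon> n\<bar> = 1)}"

end

theory Submission
  imports Defs
begin

text \<open>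
  Write $c_n = e_n^*(x)$ for the coefficients of $x$. They tend to zero because the basis vectors
  are bounded away from zero, and some $c_k$ is nonzero because $x \neq 0$. On the other hand, a
  vector $\alpha 1_{\varepsilon A}$ is \<^emph>\<open>flat\<close>: its coefficients all have modulus $|\alpha|$ on $A$
  and vanish off $A$. If it is close to $x$ then, since the functionals are uniformly bounded, all
  its coefficients are uniformly close to those of $x$. Comparison at $k$ forces $k \in A$ and
  $|\alpha| \approx |c_k|$; comparison at the other points of $A$ then forces $|c_n|$ to be at least
  about $|c_k|$ throughout $A$. Only finitely many $n$ have so large a coefficient, so $A$ cannot be
  large. This yields a uniform positive lower bound for all errors with $m$ large
  (\<open>flat_approximation_lower_bound\<close>), and the unsigned error dominates the signed one.
\<close>

lemma coefficient_signed_indicator_sum: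
  fixes e :: "nat \<Rightarrow> 'a::banach" and e' :: "nat \<Rightarrow> 'a \<Rightarrow>\<^sub>L real"
  assumes "seminormalized_schauder_basis e e'" and "finite A"
  shows "blinfun_apply (e' n) (signed_indicator_sum e \<epsilon> A) = (if n \<in> A then \<epsilon> n else 0)"
proof -
  have bio: "blinfun_apply (e' k) (e j) = (if k = j then 1 else 0)" for k j
    using assms(1) unfolding seminormalized_schauder_basis_def by blast
  have "blinfun_apply (e' n) (signed_indicator_sum e \<epsilon> A)
      = (\<Sum>j\<in>A. if n = j then \<epsilon> j else 0)"
    unfolding signed_indicator_sum_def
    by (simp add: blinfun.sum_right blinfun.scaleR_right bio if_distrib cong: if_cong)
  then show ?thesis
    using assms(2) by simp
qed

text \<open>The term $e_n^*(x) e_n$ is a difference of consecutive partial sums, hence tends to zero;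
  the lower bound on $\|e_n\|$ transfers this to the coefficients.\<close>

lemma coefficients_tendsto_zero:
  fixes e :: "nat \<Rightarrow> 'a::banach" and e' :: "nat \<Rightarrow> 'a \<Rightarrow>\<^sub>L real"
  assumes "seminormalized_schauder_basis e e'"
  shows "(\<lambda>n. blinfun_apply (e' n) x) \<longlonglongrightarrow> 0"
proof -
  obtain a where a: "a > 0" "\<And>n. a \<le> norm (e n)"
    using assms unfolding seminormalized_schauder_basis_def by blast
  have "(\<lambda>m. norm (partial_sum_proj e e' m x - x)) \<longlonglongrightarrow> 0"
    using assms unfolding seminormalized_schauder_basis_def by blast
  then have P: "(\<lambda>m. partial_sum_proj e e' m x) \<longlonglongrightarrow> x"
    using LIM_zero_iff tendsto_norm_zero_iff by blast
  have "(\<lambda>m. partial_sum_proj e e' (Suc m) x - partial_sum_proj e e' m x) \<longlonglongrightarrow> x - x"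
    by (intro tendsto_diff P LIMSEQ_Suc)
  then have "(\<lambda>n. blinfun_apply (e' n) x *\<^sub>R e n) \<longlonglongrightarrow> 0"
    by (simp add: partial_sum_proj_def)
  then have "(\<lambda>n. norm (blinfun_apply (e' n) x *\<^sub>R e n) / a) \<longlonglongrightarrow> 0"
    by (intro tendsto_divide_zero tendsto_norm_zero)
  then show ?thesis
  proof (rule Lim_null_comparison[rotated])
    have "norm (blinfun_apply (e' n) x) \<le> norm (blinfun_apply (e' n) x *\<^sub>R e n) / a" for n
      using a mult_left_mono[OF a(2)[of n], of "\<bar>blinfun_apply (e' n) x\<bar>"]
      by (simp add: pos_le_divide_eq)
    then show "\<forall>\<^sub>F n in sequentially.
        norm (blinfun_apply (e' n) x) \<le> norm (blinfun_apply (e' n) x *\<^sub>R e n) / a"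
      by simp
  qed
qed

lemma ex_nonzero_coefficient:
  fixes e :: "nat \<Rightarrow> 'a::banach" and e' :: "nat \<Rightarrow> 'a \<Rightarrow>\<^sub>L real"
  assumes "seminormalized_schauder_basis e e'" and "x \<noteq> 0"
  shows "\<exists>k. blinfun_apply (e' k) x \<noteq> 0"
proof (rule ccontr)
  assume "\<not> ?thesis"
  then have "partial_sum_proj e e' m x = 0" for m
    by (simp add: partial_sum_proj_def)
  moreover have "(\<lambda>m. norm (partial_sum_proj e e' m x - x)) \<longlonglongrightarrow> 0"
    using assms(1) unfolding seminormalized_schauder_basis_def by blast
  ultimately show False
    using assms(2) by (simp add: LIMSEQ_const_iff)
qed

text \<open>With $b$ bounding the norms of the functionals, an approximation within
  $\delta = |c_k| / (4b)$ perturbs each coefficient by at most $|c_k|/4$. Hence $k \in A$ and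
  $|\alpha| \ge 3|c_k|/4$, so $|c_n| \ge |c_k|/2$ on $A$.\<close>

lemma flat_approximation_lower_bound:
  fixes e :: "nat \<Rightarrow> 'a::banach" and e' :: "nat \<Rightarrow> 'a \<Rightarrow>\<^sub>L real"
  assumes basis: "seminormalized_schauder_basis e e'" and "x \<noteq> 0"
  obtains \<delta> N where "\<delta> > 0"
    and "\<And>A \<alpha> \<epsilon>. \<lbrakk>finite A; card A > N; \<forall>n. \<bar>\<epsilon> n\<bar> = 1\<rbrakk>
          \<Longrightarrow> \<delta> \<le> norm (x - \<alpha> *\<^sub>R signed_indicator_sum e \<epsilon> A)"
proof -
  define c where "c n = blinfun_apply (e' n) x" for n
  obtain b where b: "b > 0" "\<And>n. norm (e' n) \<le> b"
    using basis unfolding seminormalized_schauder_basis_def by blast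
  obtain k where k: "c k \<noteq> 0"
    using ex_nonzero_coefficient[OF assms] unfolding c_def by blast
  obtain N where N: "\<And>n. n \<ge> N \<Longrightarrow> \<bar>c n\<bar> < \<bar>c k\<bar> / 2"
    using LIMSEQ_D[OF coefficients_tendsto_zero[OF basis, of x], of "\<bar>c k\<bar> / 2"] k
    by (auto simp: c_def)
  define \<delta> where "\<delta> = \<bar>c k\<bar> / (4 * b)"
  show thesis
  proof (rule that)
    show "\<delta> > 0"
      using b(1) k by (simp add: \<delta>_def)
    fix A :: "nat set" and \<alpha> :: real and \<epsilon> :: "nat \<Rightarrow> real"
    assume A: "finite A" "card A > N" and \<epsilon>: "\<forall>n. \<bar>\<epsilon> n\<bar> = 1"
    show "\<delta> \<le> norm (x - \<alpha> *\<^sub>R signed_indicator_sum e \<epsilon> A)" (is "_ \<le> norm ?y")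
    proof (rule ccontr)
      assume "\<not> ?thesis"
      then have y: "norm ?y \<le> \<delta>" by simp
      have close: "\<bar>c n - \<alpha> * (if n \<in> A then \<epsilon> n else 0)\<bar> \<le> \<bar>c k\<bar> / 4" for n
      proof -
        have "\<bar>c n - \<alpha> * (if n \<in> A then \<epsilon> n else 0)\<bar> = norm (blinfun_apply (e' n) ?y)"
          by (simp add: blinfun.diff_right blinfun.scaleR_right c_def
              coefficient_signed_indicator_sum[OF basis A(1)])
        also have "\<dots> \<le> norm (e' n) * norm ?y"
          by (rule norm_blinfun)
        also have "\<dots> \<le> b * \<delta>"
          using b y by (intro mult_mono) auto
        also have "\<dots> = \<bar>c k\<bar> / 4"
          using b(1) by (simp add: \<delta>_def)
        finally show ?thesis .
      qed
      have abs_flat: "\<bar>\<alpha> * \<epsilon> n\<bar> = \<bar>\<alpha>\<bar>" for n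
        using \<epsilon> by (simp add: abs_mult)
      have "k \<in> A"
        using close[of k] k by (auto split: if_splits)
      then have \<alpha>: "\<bar>\<alpha>\<bar> \<ge> 3 * \<bar>c k\<bar> / 4"
        using close[of k] abs_flat[of k] by (simp only: if_True)
      have "n < N" if "n \<in> A" for n
      proof -
        have "\<bar>c n\<bar> \<ge> \<bar>c k\<bar> / 2"
          using close[of n] that abs_flat[of n] \<alpha> by (simp only: if_True)
        then show ?thesis
          using N[of n] by linarith
      qed
      then have "card A \<le> card {..<N}"
        by (intro card_mono) auto
      then show False
        using A(2) by simp
    qed
  qed
qed

lemma D_err_set_nonempty:
  "{norm (x - \<alpha> *\<^sub>R indicator_sum e A) | \<alpha> A. finite A \<and> card A = m} \<noteq> {}"
proof -
  have "norm (x - 0 *\<^sub>R indicator_sum e {..<m})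
      \<in> {norm (x - \<alpha> *\<^sub>R indicator_sum e A) | \<alpha> A. finite A \<and> card A = m}"
    by (intro CollectI exI conjI) (rule refl, simp_all)
  then show ?thesis
    by (metis empty_iff)
qed

lemma D_star_err_le_D_err: "D_star_err e m x \<le> D_err e m x"
  unfolding D_star_err_def D_err_def
proof (rule cInf_superset_mono[OF D_err_set_nonempty])
  show "bdd_below {norm (x - \<alpha> *\<^sub>R signed_indicator_sum e \<epsilon> A) | \<alpha> A \<epsilon>.
            finite A \<and> card A = m \<and> (\<forall>n. \<bar>\<epsilon> n\<bar> = 1)}"
    by (rule bdd_belowI[of _ 0]) auto
  show "{norm (x - \<alpha> *\<^sub>R indicator_sum e A) | \<alpha> A. finite A \<and> card A = m}
      \<subseteq> {norm (x - \<alpha> *\<^sub>R signed_indicator_sum e \<epsilon> A) | \<alpha> A \<epsilon>.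
            finite A \<and> card A = m \<and> (\<forall>n. \<bar>\<epsilon> n\<bar> = 1)}"
  proof (clarify, intro exI conjI)
    fix \<alpha> :: real and A :: "nat set"
    show "norm (x - \<alpha> *\<^sub>R indicator_sum e A)
        = norm (x - \<alpha> *\<^sub>R signed_indicator_sum e (\<lambda>_. 1) A)"
      by (simp add: indicator_sum_def signed_indicator_sum_def)
  qed auto
qed

lemma D_star_err_greatest:
  assumes "\<And>A \<alpha> \<epsilon>. \<lbrakk>finite A; card A = m; \<forall>n. \<bar>\<epsilon> n\<bar> = 1\<rbrakk>
            \<Longrightarrow> \<delta> \<le> norm (x - \<alpha> *\<^sub>R signed_indicator_sum e \<epsilon> A)"
  shows "\<delta> \<le> D_star_err e m x"
  unfolding D_star_err_def
proof (rule cInf_greatest)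
  have "norm (x - 0 *\<^sub>R signed_indicator_sum e (\<lambda>_. 1) {..<m})
      \<in> {norm (x - \<alpha> *\<^sub>R signed_indicator_sum e \<epsilon> A) | \<alpha> A \<epsilon>.
            finite A \<and> card A = m \<and> (\<forall>n. \<bar>\<epsilon> n\<bar> = 1)}"
    by (intro CollectI exI conjI) (rule refl, simp_all)
  then show "{norm (x - \<alpha> *\<^sub>R signed_indicator_sum e \<epsilon> A) | \<alpha> A \<epsilon>.
            finite A \<and> card A = m \<and> (\<forall>n. \<bar>\<epsilon> n\<bar> = 1)} \<noteq> {}"
    by (metis empty_iff)
qed (auto intro: assms)

theorem mainTheorem1:
  fixes e :: "nat \<Rightarrow> 'a::banach" and e' :: "nat \<Rightarrow> 'a \<Rightarrow>\<^sub>L real"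
  assumes "seminormalized_schauder_basis e e'"
  shows "\<forall>x. x \<noteq> 0 \<longrightarrow>
           \<not> (\<lambda>m. D_star_err e m x) \<longlonglongrightarrow> 0 \<and>
           \<not> (\<lambda>m. D_err e m x) \<longlonglongrightarrow> 0"
proof (intro allI impI)
  fix x :: 'a
  assume "x \<noteq> 0"
  then obtain \<delta> N where "\<delta> > 0"
    and lower: "\<And>A \<alpha> \<epsilon>. \<lbrakk>finite A; card A > N; \<forall>n. \<bar>\<epsilon> n\<bar> = 1\<rbrakk>
          \<Longrightarrow> \<delta> \<le> norm (x - \<alpha> *\<^sub>R signed_indicator_sum e \<epsilon> A)"
    using flat_approximation_lower_bound[OF assms] by blast
  have star: "\<delta> \<le> D_star_err e m x" if "m > N" for m
    using that by (intro D_star_err_greatest lower) auto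
  then have unsigned: "\<delta> \<le> D_err e m x" if "m > N" for m
    using that D_star_err_le_D_err order_trans by blast
  have not_null: "\<not> f \<longlonglongrightarrow> 0" if "\<And>m. m > N \<Longrightarrow> \<delta> \<le> f m" for f :: "nat \<Rightarrow> real"
  proof
    assume "f \<longlonglongrightarrow> 0"
    moreover have "\<exists>M. \<forall>m\<ge>M. \<delta> \<le> f m"
      using that by (intro exI[of _ "Suc N"]) auto
    ultimately have "\<delta> \<le> 0"
      using LIMSEQ_le_const by blast
    then show False
      using \<open>\<delta> > 0\<close> by simp
  qed
  show "\<not> (\<lambda>m. D_star_err e m x) \<longlonglongrightarrow> 0 \<and> \<not> (\<lambda>m. D_err e m x) \<longlonglongrightarrow> 0"
    by (intro conjI not_null star unsigned)
qed

end
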